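(* There is an absolute constant $C>0$ such that for every integer $q\geq 4$, every positive integer $N$, and every coloring of the edges of the complete graph on vertex set $[N]$ with $q$ colors, there exists a color-avoiding monotone path with at least $N^{1-C/\sqrt{\log q}}$ vertices.
   Context: Logarithms are to base $2$. A path in the complete graph on $[N]$ is monotone if its vertices, in the order they are traversed, are strictly increasing integers. The length of a path is its number of vertices. With colors from the palette $[q]$, a path is color-avoiding if some color of $[q]$ does not appear on any of its edges (i.e. it uses at most $q-1$ colors). *)

theory Defs
  imports Complex_Main
begin

text \<open>An edge colouring of the complete graph on [N] = {1..N} with colours [q] = {1..q}:
  the colour of the edge {i,j} with i < j is c i j (values of c on other arguments are irrelevant).\<close>
definition edge_coloring :: "nat \<Rightarrow> nat \<Rightarrow> (nat \<Rightarrow> nat \<Rightarrow> nat) \<Rightarrow> bool" where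
  "edge_coloring N q c \<longleftrightarrow> (\<forall>i j. 1 \<le> i \<and> i < j \<and> j \<le> N \<longrightarrow> c i j \<in> {1..q})"

definition monotone_path :: "nat \<Rightarrow> nat list \<Rightarrow> bool" where
  "monotone_path N xs \<longleftrightarrow> xs \<noteq> [] \<and> sorted_wrt (<) xs \<and> set xs \<subseteq> {1..N}"

definition color_avoiding :: "nat \<Rightarrow> (nat \<Rightarrow> nat \<Rightarrow> nat) \<Rightarrow> nat list \<Rightarrow> bool" where
  "color_avoiding q c xs \<longleftrightarrow>
     (\<exists>k\<in>{1..q}. \<forall>i. Suc i < length xs \<longrightarrow> c (xs ! i) (xs ! Suc i) \<noteq> k)"

end

theory Submission
  imports Defs "HOL-Analysis.Convex"
begin

text \<open>
  Let \<open>F k v\<close> be the length of a longest \<open>k\<close>-avoiding monotone path ending in \<open>v\<close>. If \<open>u < v\<close>, then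
  \<open>F k u < F k v\<close> for every \<open>k\<close> except possibly the colour of the edge \<open>uv\<close>. Split an interval of
  vertices into two halves \<open>A\<close>, \<open>B\<close>. Each pair in \<open>A \<times> B\<close> is inverted by at most one of the \<open>F k\<close>, so
  for most \<open>k\<close> the distributions of \<open>F k\<close> on \<open>A\<close> and on \<open>B\<close> overlap little, and the entropy of \<open>F k\<close> on
  \<open>A \<union> B\<close> exceeds the average of its entropies on \<open>A\<close> and \<open>B\<close> by almost one bit. Iterating over dyadic
  scales, some \<open>F k\<close> has entropy at least \<open>(1 - O(q powr (-1/4))) * log N\<close> and hence takes a value of
  at least \<open>N powr (1 - O(q powr (-1/4)))\<close>. The factor 2 lost by passing to a power of 2 below \<open>N\<close> is
  absorbed if \<open>N > q\<close>; if \<open>N \<le> q\<close>, the path through all vertices has fewer than \<open>q\<close> edges.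
\<close>

section \<open>Two real inequalities: merging under \<open>x * ln x\<close>, and overlap of two
  weights\<close>

text \<open>With \<open>y / x = s\<^sup>2\<close>, the bound \<open>1 + s\<^sup>2\<close> \<le>
  \<open>(1 + s)\<^sup>2\<close> makes the cost of replacing \<open>ln x\<close> by
  \<open>ln (x + y)\<close> at most \<open>2 * s\<close>, and \<open>x * s = sqrt (x * y)\<close>.
  The cost is incurred once for \<open>a\<close> and once for \<open>b\<close>.\<close>

lemma xlnx_add_le:
  fixes a b :: real
  assumes "a \<ge> 0" "b \<ge> 0"
  shows "(a + b) * ln (a + b) \<le> a * ln a + b * ln b + 4 * sqrt (a * b)"
proof -
  have aux: "x * ln (x + y) \<le> x * ln x + 2 * sqrt (x * y)" if "x > 0" "y > 0" for x y :: real
  proof -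
    define s where "s = sqrt (y / x)"
    have s: "s > 0" "s\<^sup>2 = y / x" using that by (simp_all add: s_def)
    have s1: "1 + s\<^sup>2 > 0" by (intro add_pos_nonneg) auto
    have "ln (x + y) = ln (x * (1 + s\<^sup>2))" using that by (simp add: s distrib_left)
    also have "\<dots> = ln x + ln (1 + s\<^sup>2)"
      using that s1 by (intro ln_mult_pos)
    also have "ln (1 + s\<^sup>2) \<le> ln ((1 + s)\<^sup>2)"
      using s(1) s1 by (intro ln_mono) (auto simp: power2_sum)
    also have "\<dots> = 2 * ln (1 + s)" using s by (simp add: ln_realpow)
    also have "\<dots> \<le> 2 * s" using ln_add_one_self_le_self[of s] s by simp
    finally have "x * ln (x + y) \<le> x * (ln x + 2 * s)"
      using that by (intro mult_left_mono) auto
    moreover have "x * s = sqrt (x * y)"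
    proof -
      have "x * s = sqrt (x\<^sup>2 * (y / x))" unfolding s_def real_sqrt_mult using that by simp
      also have "x\<^sup>2 * (y / x) = x * y" using that by (simp add: power2_eq_square)
      finally show ?thesis .
    qed
    ultimately show ?thesis by (simp add: algebra_simps)
  qed
  show ?thesis
  proof (cases "a = 0 \<or> b = 0")
    case False
    then have "a > 0" "b > 0" using assms by auto
    from aux[OF this] aux[OF this(2) this(1)] show ?thesis
      by (simp add: algebra_simps)
  qed auto
qed

lemma sum_sqrt_mult_power4_le:
  fixes a b :: "'a::linorder \<Rightarrow> real"
  assumes fin: "finite S" and a: "\<And>x. a x \<ge> 0" and b: "\<And>x. b x \<ge> 0"
  shows "(\<Sum>x\<in>S. sqrt (a x * b x)) ^ 4
    \<le> 4 * (\<Sum>x\<in>S. \<Sum>y\<in>S. if y \<le> x then a x * b y else 0) * (sum a S * sum b S)"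
proof -
  \<comment> \<open>By symmetry the square of the sum is at most twice its part over \<open>y \<le> x\<close>; there, Cauchy-Schwarz
    is applied after regrouping \<open>a x * b x * a y * b y\<close> as \<open>(a x * b y) * (a y * b x)\<close>.\<close>
  define P where "P = {p \<in> S \<times> S. snd p \<le> fst p}"
  define f where "f = (\<lambda>p. sqrt (a (fst p) * b (snd p)))"
  define g where "g = (\<lambda>p. sqrt (a (snd p) * b (fst p)))"
  define w where "w = (\<lambda>x. sqrt (a x * b x))"
  have w0: "w x \<ge> 0" for x using a b by (simp add: w_def)
  have finP: "finite P" using fin by (simp add: P_def)
  have ww: "w (fst p) * w (snd p) = f p * g p" for p
    by (simp add: w_def f_def g_def real_sqrt_mult[symmetric] mult_ac)
  have "(sum w S)\<^sup>2 = (\<Sum>p\<in>S \<times> S. w (fst p) * w (snd p))"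
    by (simp add: power2_eq_square sum_product sum.cartesian_product case_prod_beta)
  also have "S \<times> S = P \<union> prod.swap ` P"
    by (auto simp: P_def image_iff)
  also have "(\<Sum>p\<in>P \<union> prod.swap ` P. w (fst p) * w (snd p))
     \<le> (\<Sum>p\<in>P. w (fst p) * w (snd p)) + (\<Sum>p\<in>prod.swap ` P. w (fst p) * w (snd p))"
    using finP by (subst sum_Un) (auto intro!: sum_nonneg mult_nonneg_nonneg w0)
  also have "(\<Sum>p\<in>prod.swap ` P. w (fst p) * w (snd p)) = (\<Sum>p\<in>P. w (fst p) * w (snd p))"
    by (subst sum.reindex) (auto simp: mult.commute)
  finally have 1: "(sum w S)\<^sup>2 \<le> 2 * (\<Sum>p\<in>P. f p * g p)" by (simp add: ww)
  have "(sum w S) ^ 4 = ((sum w S)\<^sup>2)\<^sup>2" by simp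
  also have "\<dots> \<le> (2 * (\<Sum>p\<in>P. f p * g p))\<^sup>2"
    using 1 by (intro power_mono) auto
  also have "\<dots> = 4 * (\<Sum>p\<in>P. f p * g p)\<^sup>2" by (simp add: power_mult_distrib)
  also have "(\<Sum>p\<in>P. f p * g p)\<^sup>2 \<le> (\<Sum>p\<in>P. (f p)\<^sup>2) * (\<Sum>p\<in>P. (g p)\<^sup>2)"
    by (rule Cauchy_Schwarz_ineq_sum)
  also have "(\<Sum>p\<in>P. (f p)\<^sup>2) = (\<Sum>p\<in>P. a (fst p) * b (snd p))"
    using a b by (simp add: f_def)
  also have "\<dots> = (\<Sum>p\<in>S \<times> S. if snd p \<le> fst p then a (fst p) * b (snd p) else 0)"
    unfolding P_def using fin by (subst sum.inter_filter) auto
  also have "\<dots> = (\<Sum>x\<in>S. \<Sum>y\<in>S. if y \<le> x then a x * b y else 0)"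
    by (simp add: sum.cartesian_product case_prod_beta)
  also have "(\<Sum>p\<in>P. (g p)\<^sup>2) = (\<Sum>p\<in>P. b (fst p) * a (snd p))"
    using a b by (simp add: g_def mult.commute)
  \<comment> \<open>Only the first Cauchy-Schwarz factor keeps the restriction to \<open>P\<close>;
    this one may grow to all pairs.\<close>
  also have "\<dots> \<le> (\<Sum>p\<in>S \<times> S. b (fst p) * a (snd p))"
    using fin a b by (intro sum_mono2) (auto simp: P_def)
  also have "\<dots> = sum b S * sum a S"
    by (simp add: sum_product sum.cartesian_product case_prod_beta)
  finally show ?thesis using a b
    by (simp add: w_def mult_left_mono sum_nonneg mult.assoc mult.commute[of "sum b S"])
qed

section \<open>Fibre sizes, inversions and entropy\<close>

definition fibre_card :: "('a \<Rightarrow> 'b) \<Rightarrow> 'a set \<Rightarrow> 'b \<Rightarrow> real" where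
  "fibre_card f A x = real (card {v \<in> A. f v = x})"

text \<open>Up to normalisation a negative entropy: if \<open>f\<close> maps \<open>A\<close> into \<open>S\<close>, then the value is
  \<open>card A * (ln (card A) - H)\<close>, where \<open>H\<close> is the entropy of \<open>f\<close> at a uniformly random point of \<open>A\<close>.
  Empty fibres contribute 0 because \<open>ln 0 = 0\<close>.\<close>
definition fibre_xlnx :: "'b set \<Rightarrow> ('a \<Rightarrow> 'b) \<Rightarrow> 'a set \<Rightarrow> real" where
  "fibre_xlnx S f A = (\<Sum>x\<in>S. fibre_card f A x * ln (fibre_card f A x))"

text \<open>Ties count, so that an inversion is exactly a failure of strict increase from
  \<open>A\<close> to \<open>B\<close>.\<close>

definition inversions :: "('a \<Rightarrow> 'b::linorder) \<Rightarrow> 'a set \<Rightarrow> 'a set \<Rightarrow> ('a \<times> 'a) set" where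
  "inversions f A B = {p \<in> A \<times> B. f (snd p) \<le> f (fst p)}"

lemma sum_fibre_card:
  assumes "finite S" "finite A" "f ` A \<subseteq> S"
  shows "(\<Sum>x\<in>S. fibre_card f A x) = real (card A)"
proof -
  have "(\<Sum>x\<in>S. card {v \<in> A. f v = x}) = card A"
    using sum.group[OF assms(2,1,3), of "\<lambda>_. 1::nat"] by simp
  then show ?thesis unfolding fibre_card_def by (metis of_nat_sum)
qed

text \<open>Grouping inversions by their pair of values identifies their number with the double sum
  in \<open>sum_sqrt_mult_power4_le\<close>; few inversions thus force a small overlap.\<close>

lemma card_inversions:
  assumes "finite S" "finite A" "finite B" "f ` A \<subseteq> S" "f ` B \<subseteq> S"
  shows "real (card (inversions f A B))
    = (\<Sum>x\<in>S. \<Sum>y\<in>S. if y \<le> x then fibre_card f A x * fibre_card f B y else 0)"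
proof -
  let ?g = "\<lambda>p. (f (fst p), f (snd p))"
  have "card (inversions f A B) = (\<Sum>p\<in>inversions f A B. 1)" by simp
  also have "\<dots> = (\<Sum>z\<in>S \<times> S. \<Sum>p\<in>{p \<in> inversions f A B. ?g p = z}. 1)"
    using assms by (intro sum.group[symmetric])
      (auto simp: inversions_def intro: finite_subset[of _ "A \<times> B"])
  also have "\<dots> = (\<Sum>z\<in>S \<times> S. card {p \<in> inversions f A B. ?g p = z})" by simp
  also have "\<dots> = (\<Sum>z\<in>S \<times> S. if snd z \<le> fst z
      then card {v \<in> A. f v = fst z} * card {v \<in> B. f v = snd z} else 0)"
  proof (rule sum.cong[OF refl])
    fix z
    have "{p \<in> inversions f A B. ?g p = z} =
      (if snd z \<le> fst z then {v \<in> A. f v = fst z} \<times> {v \<in> B. f v = snd z} else {})"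
      by (auto simp: inversions_def)
    then show "card {p \<in> inversions f A B. ?g p = z} = (if snd z \<le> fst z
      then card {v \<in> A. f v = fst z} * card {v \<in> B. f v = snd z} else 0)"
      by (simp add: card_cartesian_product)
  qed
  finally have "real (card (inversions f A B)) = (\<Sum>z\<in>S \<times> S. if snd z \<le> fst z
      then fibre_card f A (fst z) * fibre_card f B (snd z) else 0)"
    by (simp add: fibre_card_def if_distrib[of real] cong: if_cong)
  then show ?thesis by (simp add: sum.cartesian_product case_prod_beta)
qed

text \<open>If \<open>f\<close> maps both sets into \<open>S\<close> and both have size
  \<open>M > 0\<close>, this says that the entropy on the union exceeds the average of the two
  entropies by at least \<open>ln 2\<close> minus \<open>2 / M\<close> times the overlap
  sum.\<close>

lemma fibre_xlnx_Un_le: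
  assumes "finite S" "finite A" "finite B" "A \<inter> B = {}"
  shows "fibre_xlnx S f (A \<union> B) \<le> fibre_xlnx S f A + fibre_xlnx S f B
    + 4 * (\<Sum>x\<in>S. sqrt (fibre_card f A x * fibre_card f B x))"
proof -
  have "fibre_card f (A \<union> B) x = fibre_card f A x + fibre_card f B x" for x
  proof -
    have "{v \<in> A \<union> B. f v = x} = {v \<in> A. f v = x} \<union> {v \<in> B. f v = x}" by auto
    moreover have "card \<dots> = card {v \<in> A. f v = x} + card {v \<in> B. f v = x}"
      using assms by (intro card_Un_disjoint) auto
    ultimately show ?thesis by (simp add: fibre_card_def)
  qed
  then have "fibre_xlnx S f (A \<union> B) \<le> (\<Sum>x\<in>S. fibre_card f A x * ln (fibre_card f A x)
     + fibre_card f B x * ln (fibre_card f B x) + 4 * sqrt (fibre_card f A x * fibre_card f B x))"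
    unfolding fibre_xlnx_def by (auto intro!: sum_mono xlnx_add_le simp: fibre_card_def)
  then show ?thesis by (simp add: fibre_xlnx_def sum.distrib sum_distrib_left)
qed

text \<open>Entropy is at most \<open>ln (card S)\<close>: each term is bounded below by the tangent
  of \<open>c * ln c\<close> at the mean fibre size \<open>t\<close>, and the corrections
  \<open>c - t\<close> sum to 0.\<close>

lemma fibre_xlnx_ge:
  assumes "finite S" "finite A" "f ` A \<subseteq> S" "A \<noteq> {}"
  shows "real (card A) * ln (real (card A) / real (card S)) \<le> fibre_xlnx S f A"
proof -
  define t where "t = real (card A) / real (card S)"
  have S: "card S > 0" using assms by (auto simp: card_gt_0_iff)
  have A: "card A > 0" using assms by (auto simp: card_gt_0_iff)
  have t: "t > 0" using S A by (simp add: t_def)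
  have "c * ln t + c - t \<le> c * ln c" if "c \<ge> 0" for c :: real
  proof (cases "c = 0")
    case False
    then have "c > 0" using that by simp
    then have "ln (t / c) \<le> t / c - 1" using t by (intro ln_le_minus_one) auto
    then have "c * (ln t - ln c) \<le> c * (t / c - 1)"
      using \<open>c > 0\<close> t by (intro mult_left_mono) (auto simp: ln_div)
    then show ?thesis using \<open>c > 0\<close> by (simp add: algebra_simps)
  qed (use t in auto)
  then have "(\<Sum>x\<in>S. fibre_card f A x * ln t + fibre_card f A x - t) \<le> fibre_xlnx S f A"
    unfolding fibre_xlnx_def by (intro sum_mono) (auto simp: fibre_card_def)
  moreover have "(\<Sum>x\<in>S. fibre_card f A x * ln t + fibre_card f A x - t)
      = real (card A) * ln t + real (card A) - real (card S) * t"
    by (simp add: sum.distrib sum_subtractf sum_distrib_right[symmetric] sum_fibre_card[OF assms(1-3)])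
  moreover have "real (card S) * t = real (card A)" using S by (simp add: t_def)
  ultimately show ?thesis by (simp add: t_def)
qed

section \<open>Summation over colours and over dyadic scales\<close>

text \<open>By \<open>almost\<close>, the inversion sets for different \<open>k\<close> are disjoint
  subsets of \<open>A \<times> B\<close>, so all \<open>k\<close> share a budget of
  \<open>M\<^sup>2\<close> inversions. The constant is 1 + 4, from small and large overlaps.\<close>

lemma sum_fibre_overlap_le:
  fixes F :: "'k \<Rightarrow> 'a \<Rightarrow> 'b::linorder"
  assumes fin: "finite K" "K \<noteq> {}" "finite S" "finite A" "finite B"
    and S: "\<And>k. k \<in> K \<Longrightarrow> F k ` A \<subseteq> S" "\<And>k. k \<in> K \<Longrightarrow> F k ` B \<subseteq> S"
    and M: "card A = M" "card B = M"
    and almost: "\<And>u v. u \<in> A \<Longrightarrow> v \<in> B \<Longrightarrow> \<exists>c. \<forall>k\<in>K - {c}. F k u < F k v"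
  shows "(\<Sum>k\<in>K. \<Sum>x\<in>S. sqrt (fibre_card (F k) A x * fibre_card (F k) B x))
    \<le> 5 * real (card K) powr (3/4) * real M"
proof -
  define W where "W = (\<lambda>k. \<Sum>x\<in>S. sqrt (fibre_card (F k) A x * fibre_card (F k) B x))"
  define D where "D = (\<lambda>k. real (card (inversions (F k) A B)))"
  have W0: "W k \<ge> 0" for k by (auto simp: W_def fibre_card_def intro!: sum_nonneg)
  have W4: "W k ^ 4 \<le> 4 * D k * real M ^ 2" if "k \<in> K" for k
    using sum_sqrt_mult_power4_le[OF fin(3), of "fibre_card (F k) A" "fibre_card (F k) B"]
    by (simp add: W_def D_def card_inversions[OF fin(3-5) S[OF that]] fibre_card_def[of "F k" A]
        sum_fibre_card[OF fin(3,4) S(1)[OF that], unfolded fibre_card_def] fibre_card_def[of "F k" B]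
        sum_fibre_card[OF fin(3,5) S(2)[OF that], unfolded fibre_card_def] M power2_eq_square)
  have "\<forall>k\<in>K. \<forall>l\<in>K. k \<noteq> l \<longrightarrow> inversions (F k) A B \<inter> inversions (F l) A B = {}"
  proof (intro ballI impI, rule ccontr)
    fix k l assume kl: "k \<in> K" "l \<in> K" "k \<noteq> l" "inversions (F k) A B \<inter> inversions (F l) A B \<noteq> {}"
    then obtain u v where "u \<in> A" "v \<in> B" "F k v \<le> F k u" "F l v \<le> F l u"
      by (auto simp: inversions_def)
    with almost[of u v] kl show False by (metis Diff_iff leD singletonD)
  qed
  then have "card (\<Union>k\<in>K. inversions (F k) A B) = (\<Sum>k\<in>K. card (inversions (F k) A B))"
    using fin by (intro card_UN_disjoint)
      (auto simp: inversions_def)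
  moreover have "card (\<Union>k\<in>K. inversions (F k) A B) \<le> card (A \<times> B)"
    using fin by (intro card_mono) (auto simp: inversions_def)
  ultimately have "(\<Sum>k\<in>K. card (inversions (F k) A B)) \<le> M ^ 2"
    by (simp add: card_cartesian_product M power2_eq_square)
  then have D: "sum D K \<le> real M ^ 2"
    unfolding D_def of_nat_sum[symmetric] of_nat_power[symmetric] by (rule of_nat_mono)
  define q where "q = real (card K)"
  have q: "q > 0" using fin by (simp add: q_def card_gt_0_iff)
  show ?thesis
  proof (cases "M = 0")
    case True
    then have "A = {}" using M fin by auto
    then show ?thesis by (simp add: fibre_card_def)
  next
    case False
    \<comment> \<open>\<open>W k \<le> lam\<close> or \<open>W k \<le> W k ^ 4 / lam ^ 3\<close>; this choice of \<open>lam\<close> balances the two sums.\<close>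
    define lam where "lam = q powr (-1/4) * real M"
    have lam: "lam > 0" using q False by (simp add: lam_def)
    have lam3: "lam ^ 3 = q powr (-3/4) * real M ^ 3"
      using q by (simp add: lam_def power_mult_distrib powr_power)
    have Wle: "W k \<le> lam + W k ^ 4 / lam ^ 3" for k
    proof (cases "W k \<le> lam")
      case True then show ?thesis using W0[of k] lam by (simp add: add_increasing2)
    next
      case False
      then have "W k * lam ^ 3 \<le> W k * W k ^ 3"
        using lam W0[of k] by (intro mult_left_mono power_mono) auto
      then have "W k \<le> W k ^ 4 / lam ^ 3" using lam
        by (simp add: pos_le_divide_eq power4_eq_xxxx power3_eq_cube mult_ac)
      then show ?thesis using lam by simp
    qed
    have "sum W K \<le> (\<Sum>k\<in>K. lam + (4 * D k * real M ^ 2) / lam ^ 3)"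
    proof (rule sum_mono)
      fix k assume "k \<in> K"
      have "W k ^ 4 / lam ^ 3 \<le> (4 * D k * real M ^ 2) / lam ^ 3"
        using W4[OF \<open>k \<in> K\<close>] lam by (intro divide_right_mono) auto
      with Wle[of k] show "W k \<le> lam + (4 * D k * real M ^ 2) / lam ^ 3" by linarith
    qed
    also have "\<dots> = q * lam + 4 * real M ^ 2 / lam ^ 3 * sum D K"
      by (simp add: sum.distrib q_def sum_distrib_left sum_divide_distrib mult_ac sum_distrib_right)
    also have "\<dots> \<le> q * lam + 4 * real M ^ 2 / lam ^ 3 * real M ^ 2"
      using D lam by (intro add_left_mono mult_left_mono) auto
    also have "q * lam = q powr (3/4) * real M"
      using powr_add[of q 1 "-1/4"] q by (simp add: lam_def)
    also have "4 * real M ^ 2 / lam ^ 3 * real M ^ 2 = 4 * q powr (3/4) * real M"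
    proof -
      have "4 * x ^ 2 / (inverse p * x ^ 3) * x ^ 2 = 4 * p * x" if "x > 0" "p > 0" for x p :: real
        using that by (simp add: divide_simps power2_eq_square power3_eq_cube)
      from this[of "real M" "q powr (3/4)"] show ?thesis
        using False q by (simp add: lam3 powr_minus)
    qed
    finally show ?thesis by (simp add: W_def q_def mult_ac)
  qed
qed

text \<open>Joining two halves of size \<open>2 ^ m\<close> costs
  \<open>4 * 5 * 2 ^ m = 10 * 2 ^ Suc m\<close> times the power of \<open>card K\<close>, the same
  amount per vertex at each of the \<open>m\<close> levels.\<close>

lemma sum_fibre_xlnx_dyadic_le:
  fixes F :: "'k \<Rightarrow> nat \<Rightarrow> 'b::linorder"
  assumes fin: "finite K" "K \<noteq> {}" "finite S"
    and "\<And>k. k \<in> K \<Longrightarrow> F k ` {s..<s + 2 ^ m} \<subseteq> S"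
    and "\<And>u v. s \<le> u \<Longrightarrow> u < v \<Longrightarrow> v < s + 2 ^ m \<Longrightarrow> \<exists>c. \<forall>k\<in>K - {c}. F k u < F k v"
  shows "(\<Sum>k\<in>K. fibre_xlnx S (F k) {s..<s + 2 ^ m})
    \<le> 10 * real (card K) powr (3/4) * real m * 2 ^ m"
  using assms(4,5)
proof (induction m arbitrary: s)
  case 0
  \<comment> \<open>On a single vertex all fibre sizes are 0 or 1, where \<open>x * ln x\<close>
    vanishes.\<close>
  have "fibre_xlnx S (F k) {s..<s + 2 ^ 0} \<le> 0" for k
  proof -
    have "fibre_card (F k) {s..<s + 2 ^ 0} x \<le> 1" for x
      unfolding fibre_card_def by (simp add: card_le_Suc0_iff_eq)
    moreover have "fibre_card (F k) {s..<s + 2 ^ 0} x \<ge> 0" for x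
      unfolding fibre_card_def by simp
    ultimately show ?thesis unfolding fibre_xlnx_def
      by (auto intro!: sum_nonpos mult_nonneg_nonpos simp: ln_le_zero_iff)
        (metis ln_0 ln_le_zero_iff order_le_less)
  qed
  then show ?case by (simp add: sum_nonpos)
next
  case (Suc m)
  let ?A = "{s..<s + 2 ^ m}" and ?B = "{s + 2 ^ m..<(s + 2 ^ m) + 2 ^ m}"
  let ?q = "real (card K) powr (3/4)"
  have AB: "{s..<s + 2 ^ Suc m} = ?A \<union> ?B" by auto
  have S: "F k ` ?A \<subseteq> S" "F k ` ?B \<subseteq> S" if "k \<in> K" for k
    using Suc.prems(1)[OF that] unfolding AB by blast+
  have almost: "\<exists>c. \<forall>k\<in>K - {c}. F k u < F k v" if "s \<le> u" "u < v" "v < s + 2 ^ m + 2 ^ m" for u v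
    using Suc.prems(2)[of u v] that by simp
  have "(\<Sum>k\<in>K. fibre_xlnx S (F k) (?A \<union> ?B)) \<le> (\<Sum>k\<in>K. fibre_xlnx S (F k) ?A
     + fibre_xlnx S (F k) ?B + 4 * (\<Sum>x\<in>S. sqrt (fibre_card (F k) ?A x * fibre_card (F k) ?B x)))"
    using fin by (intro sum_mono fibre_xlnx_Un_le) auto
  also have "\<dots> = (\<Sum>k\<in>K. fibre_xlnx S (F k) ?A) + (\<Sum>k\<in>K. fibre_xlnx S (F k) ?B)
     + 4 * (\<Sum>k\<in>K. \<Sum>x\<in>S. sqrt (fibre_card (F k) ?A x * fibre_card (F k) ?B x))"
    by (simp add: sum.distrib sum_distrib_left)
  also have "\<dots> \<le> 10 * ?q * real m * 2 ^ m + 10 * ?q * real m * 2 ^ m + 4 * (5 * ?q * real (2 ^ m))"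
    using fin S almost
    by (intro add_mono mult_left_mono Suc.IH sum_fibre_overlap_le) auto
  also have "\<dots> = 10 * ?q * real (Suc m) * 2 ^ Suc m" by (simp add: algebra_simps)
  finally show ?case unfolding AB .
qed

section \<open>Longest colour-avoiding paths\<close>

definition avoiding_paths :: "nat \<Rightarrow> (nat \<Rightarrow> nat \<Rightarrow> nat) \<Rightarrow> nat \<Rightarrow> nat \<Rightarrow> nat list set" where
  "avoiding_paths N c k v =
    {xs. monotone_path N xs \<and> last xs = v \<and> successively (\<lambda>x y. c x y \<noteq> k) xs}"

definition longest :: "nat \<Rightarrow> (nat \<Rightarrow> nat \<Rightarrow> nat) \<Rightarrow> nat \<Rightarrow> nat \<Rightarrow> nat" where
  "longest N c k v = Max (length ` avoiding_paths N c k v)"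

lemma finite_avoiding_paths: "finite (avoiding_paths N c k v)"
proof (rule finite_subset)
  show "avoiding_paths N c k v \<subseteq> {xs. set xs \<subseteq> {1..N} \<and> length xs \<le> N}"
  proof
    fix xs assume "xs \<in> avoiding_paths N c k v"
    then have xs: "sorted_wrt (<) xs" "set xs \<subseteq> {1..N}"
      by (auto simp: avoiding_paths_def monotone_path_def)
    then have "length xs = card (set xs)"
      using distinct_card strict_sorted_iff by metis
    also have "\<dots> \<le> N" using card_mono[OF _ xs(2)] by simp
    finally show "xs \<in> {xs. set xs \<subseteq> {1..N} \<and> length xs \<le> N}" using xs by simp
  qed
  show "finite {xs. set xs \<subseteq> {1..N} \<and> length xs \<le> N}"
    by (rule finite_lists_length_le) simp
qed

lemma longest_attained:
  assumes "v \<in> {1..N}"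
  obtains xs where "xs \<in> avoiding_paths N c k v" "length xs = longest N c k v"
proof -
  have "[v] \<in> avoiding_paths N c k v"
    using assms by (simp add: avoiding_paths_def monotone_path_def)
  then have "longest N c k v \<in> length ` avoiding_paths N c k v"
    unfolding longest_def using finite_avoiding_paths by (intro Max_in) auto
  then show ?thesis using that by auto
qed

text \<open>A longest path ending in \<open>u\<close> extends by \<open>v\<close>. Hence only the
  colour \<open>c u v\<close> can violate the strict increase, as the entropy argument
  requires.\<close>

lemma longest_less:
  assumes "u \<in> {1..N}" "v \<in> {1..N}" "u < v" "c u v \<noteq> k"
  shows "longest N c k u < longest N c k v"
proof -
  obtain xs where xs: "xs \<in> avoiding_paths N c k u" "length xs = longest N c k u"
    using longest_attained assms(1) .
  have "x \<le> last xs" if "x \<in> set xs" "sorted_wrt (<) xs" for x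
    using that by (induction xs) (auto simp: less_imp_le)
  then have "xs @ [v] \<in> avoiding_paths N c k v"
    using xs(1) assms
    by (force simp: avoiding_paths_def monotone_path_def sorted_wrt_append successively_append_iff)
  then have "length (xs @ [v]) \<le> longest N c k v"
    unfolding longest_def using finite_avoiding_paths by (intro Max_ge imageI) auto
  then show ?thesis using xs(2) by simp
qed

lemma exists_color_avoiding_path:
  assumes q: "q \<ge> 1" and col: "edge_coloring N q c" and m: "2 ^ m \<le> N"
  shows "\<exists>xs. monotone_path N xs \<and> color_avoiding q c xs \<and>
    2 ^ m * exp (- (10 * real q powr (-1/4) * real m)) \<le> real (length xs)"
proof -
  define F where "F = longest N c"
  define E where "E = 10 * real q powr (-1/4) * real m"
  define L where "L = (\<lambda>(k, v). F k v) ` ({1..q} \<times> {1..N})"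
  \<comment> \<open>The maximum runs over all colours, so \<open>{1..n}\<close> contains the values
    of every \<open>F k\<close>. The path attaining it avoids \<open>k0\<close>, which may differ
    from the colour \<open>k\<close> chosen below by averaging.\<close>
  define n where "n = Max L"
  have N: "N \<ge> 1" using m by (metis one_le_numeral one_le_power order_trans)
  have finL: "finite L" "L \<noteq> {}" using q N by (auto simp: L_def)
  from Max_in[OF this] obtain k0 v0 where kv: "k0 \<in> {1..q}" "v0 \<in> {1..N}" "n = F k0 v0"
    by (auto simp: L_def n_def)
  from kv(2) obtain xs where xs: "xs \<in> avoiding_paths N c k0 v0" "length xs = n"
    using kv(3) unfolding F_def by (metis longest_attained)
  have "n \<ge> 1" using xs by (auto simp: avoiding_paths_def monotone_path_def Suc_le_eq)
  have F1: "F k v \<ge> 1" if "v \<in> {1..N}" for k v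
    using longest_attained[OF that, of c k] unfolding F_def
    by (metis (no_types, lifting) One_nat_def Suc_leI avoiding_paths_def length_greater_0_conv mem_Collect_eq monotone_path_def)
  have range: "F k ` {1..<1 + 2 ^ m} \<subseteq> {1..n}" if "k \<in> {1..q}" for k
  proof
    fix x assume "x \<in> F k ` {1..<1 + 2 ^ m}"
    then obtain v where "v \<in> {1..<1 + 2 ^ m}" and v2: "x = F k v" by auto
    then have v: "v \<in> {1..N}" "x = F k v" using m by auto
    then have "x \<in> L" using that by (force simp: L_def)
    then show "x \<in> {1..n}" using F1[OF v(1)] v(2) finL by (simp add: n_def)
  qed
  have "(\<Sum>k\<in>{1..q}. fibre_xlnx {1..n} (F k) {1..<1 + 2 ^ m})
      \<le> 10 * real (card {1..q}) powr (3/4) * real m * 2 ^ m"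
  proof (rule sum_fibre_xlnx_dyadic_le)
    fix u v :: nat assume "1 \<le> u" "u < v" "v < 1 + 2 ^ m"
    then show "\<exists>d. \<forall>k\<in>{1..q} - {d}. F k u < F k v"
      using m by (intro exI[of _ "c u v"]) (auto simp: F_def intro!: longest_less)
  qed (use q range in auto)
  also have "\<dots> = real (card {1..q}) * (E * 2 ^ m)"
    using q powr_add[of "real q" 1 "-1/4"] by (simp add: E_def)
  \<comment> \<open>The negated strict form rules out that every colour exceeds the average bound
    \<open>E * 2 ^ m\<close>.\<close>
  finally have "\<not> (\<Sum>k\<in>{1..q}. E * 2 ^ m)
      < (\<Sum>k\<in>{1..q}. fibre_xlnx {1..n} (F k) {1..<1 + 2 ^ m})" by simp
  then obtain k where k: "k \<in> {1..q}" "fibre_xlnx {1..n} (F k) {1..<1 + 2 ^ m} \<le> E * 2 ^ m"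
    using q sum_strict_mono[of "{1..q}" "\<lambda>_. E * 2 ^ m"
        "\<lambda>k. fibre_xlnx {1..n} (F k) {1..<1 + 2 ^ m}"] by (force simp: not_less)
  \<comment> \<open>For this \<open>k\<close> the entropy is at least \<open>m * ln 2 - E\<close>,
    but \<open>n\<close> possible values allow at most \<open>ln n\<close>.\<close>
  have "2 ^ m * ln (2 ^ m / real n) \<le> fibre_xlnx {1..n} (F k) {1..<1 + 2 ^ m}"
    using fibre_xlnx_ge[OF _ _ range[OF k(1)]] by simp
  with k(2) have "2 ^ m * ln (2 ^ m / real n) \<le> 2 ^ m * E"
    by (subst (asm) mult.commute[of E]) (rule order_trans)
  then have "ln (2 ^ m / real n) \<le> E" by (rule mult_left_le_imp_le) simp
  then have "2 ^ m / real n \<le> exp E"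
    using \<open>n \<ge> 1\<close> by (metis divide_pos_pos exp_le_cancel_iff exp_ln less_le_trans of_nat_0_less_iff zero_less_numeral zero_less_one zero_less_power)
  then have "2 ^ m * exp (- E) \<le> real n"
    using \<open>n \<ge> 1\<close> by (simp add: exp_minus field_simps)
  moreover have "color_avoiding q c xs"
    using xs(1) kv(1) unfolding color_avoiding_def avoiding_paths_def
    by (auto simp: successively_conv_nth)
  ultimately show ?thesis
    using xs unfolding E_def avoiding_paths_def by blast
qed

section \<open>Constants and the final bound\<close>

lemma divide_ln2_le:
  assumes "y \<ge> (0::real)"
  shows "y / ln 2 \<le> 2 * y"
proof -
  have "1 \<le> 2 * ln (2::real)" using ln_le_minus_one[of "1/2::real"] by (simp add: ln_div)
  then have "y * 1 \<le> y * (2 * ln 2)" using assms by (rule mult_left_mono)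
  then show ?thesis by (simp add: field_simps)
qed

text \<open>Follows from \<open>ln y\<close> \<le> \<open>y\<close> at
  \<open>y = x powr (1/2)\<close>. It weakens the saving \<open>q powr (-1/4)\<close> to the form
  \<open>1 / sqrt (log 2 q)\<close>.\<close>

lemma sqrt_log2_le_powr_quarter:
  assumes "x > (0::real)"
  shows "sqrt (log 2 x) \<le> 2 * x powr (1/4)"
proof -
  have "ln x = 2 * ln (x powr (1/2))" using assms by (simp add: ln_powr)
  also have "\<dots> \<le> 2 * x powr (1/2)" using assms ln_less_self[of "x powr (1/2)"] by simp
  finally have "log 2 x \<le> 2 * x powr (1/2) / ln 2"
    by (simp add: log_def divide_right_mono)
  also have "\<dots> \<le> 4 * x powr (1/2)"
    using divide_ln2_le[of "2 * x powr (1/2)"] by simp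
  also have "\<dots> = (2 * x powr (1/4))\<^sup>2" using assms by (simp add: power_mult_distrib powr_power)
  finally show ?thesis by (simp add: real_le_lsqrt)
qed

theorem theorem1p5:
  "\<exists>C::real. C > 0 \<and>
     (\<forall>q N c. q \<ge> 4 \<longrightarrow> N \<ge> 1 \<longrightarrow> edge_coloring N q c \<longrightarrow>
        (\<exists>xs. monotone_path N xs \<and> color_avoiding q c xs \<and>
              real (length xs) \<ge> real N powr (1 - C / sqrt (log 2 (real q)))))"
\<comment> \<open>Here 40 = 10 * 2 * 2: the entropy loss, \<open>q powr (-1/4)\<close> \<le>
  \<open>2 / r\<close>, and \<open>log 2 N\<close> \<le> \<open>2 * ln N\<close>. The remaining 1
  pays for rounding \<open>N\<close> down to a power of 2.\<close>
proof (intro exI[of _ "41::real"] conjI allI impI)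
  fix q N :: nat and c
  assume q: "q \<ge> 4" and N: "N \<ge> 1" and col: "edge_coloring N q c"
  define r where "r = sqrt (log 2 (real q))"
  have log2: "log 2 (real q) \<ge> 2"
    using q by (subst le_log_iff) auto
  then have r1: "r \<ge> 1" by (simp add: r_def)
  show "\<exists>xs. monotone_path N xs \<and> color_avoiding q c xs \<and>
              real (length xs) \<ge> real N powr (1 - 41 / sqrt (log 2 (real q)))"
  proof (cases "N \<le> q")
    case True
    define xs where "xs = [1..<Suc N]"
    let ?U = "(\<lambda>i. c (xs ! i) (xs ! Suc i)) ` {..<N - 1}"
    have "card ?U \<le> N - 1" using card_image_le[of "{..<N - 1}"] by simp
    then have "card ?U < card {1..q}" using True N by simp
    then have "\<not> {1..q} \<subseteq> ?U" using card_mono[of ?U "{1..q}"] by auto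
    then obtain k where k: "k \<in> {1..q}" "k \<notin> ?U" by blast
    have "color_avoiding q c xs"
      unfolding color_avoiding_def
      by (rule bexI[OF _ k(1)]) (use k(2) in \<open>auto simp: xs_def image_iff simp del: upt_Suc\<close>)
    moreover have "monotone_path N xs"
      using N by (auto simp: monotone_path_def xs_def simp del: upt_Suc)
    moreover have "real N powr (1 - 41 / r) \<le> real N powr 1"
      using N r1 by (intro powr_mono) auto
    ultimately show ?thesis using N by (intro exI[of _ xs]) (auto simp: xs_def r_def simp del: upt_Suc)
  next
    case False
    define m where "m = nat \<lfloor>log 2 (real N)\<rfloor>"
    have logN0: "log 2 (real N) \<ge> 0" using N by simp
    have "real m \<le> log 2 (real N)" "log 2 (real N) < real m + 1"
      unfolding m_def using logN0 by linarith+
    then have m: "2 powr real m \<le> real N" "real N < 2 powr (real m + 1)" "real m \<le> log 2 (real N)"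
      using N by (simp_all add: le_log_iff log_less_iff)
    have "real (2 ^ m) \<le> real N" using m(1) by (simp add: powr_realpow)
    then have "2 ^ m \<le> N" by linarith
    from exists_color_avoiding_path[OF _ col this] q obtain xs where
      xs: "monotone_path N xs" "color_avoiding q c xs"
        "2 ^ m * exp (- (10 * real q powr (-1/4) * real m)) \<le> real (length xs)" by auto
    have "real q powr (-1/4) \<le> 2 / r"
      using sqrt_log2_le_powr_quarter[of "real q"] q r1
      by (simp add: r_def powr_minus field_simps)
    then have "10 * real q powr (-1/4) * real m \<le> 10 * (2 / r) * log 2 (real N)"
      using m(3) r1 by (intro mult_mono) auto
    also have "\<dots> \<le> 40 / r * ln (real N)"
    proof -
      have "log 2 (real N) \<le> 2 * ln (real N)"
        using N divide_ln2_le[of "ln (real N)"] by (simp add: log_def)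
      then show ?thesis using r1 by (simp add: field_simps)
    qed
    finally have e: "exp (- (40 / r * ln (real N))) \<le> exp (- (10 * real q powr (-1/4) * real m))"
      by simp
    \<comment> \<open>Since \<open>r\<close> \<le> \<open>log 2 q\<close> \<le>
      \<open>log 2 N\<close>, the power \<open>N powr (1 / r)\<close> is at least 2 and covers the
      rounding loss.\<close>
    have "r \<le> log 2 (real q)"
    proof -
      have "r * 1 \<le> r * r" using r1 by (intro mult_left_mono) auto
      also have "r * r = log 2 (real q)" using log2 by (simp add: r_def)
      finally show ?thesis by simp
    qed
    also have "\<dots> \<le> log 2 (real N)" using False q by simp
    finally have "1 \<le> 1 / r * log 2 (real N)" using r1 by (simp add: field_simps)
    then have "2 powr 1 \<le> 2 powr (1 / r * log 2 (real N))" by (intro powr_mono) auto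
    also have "\<dots> = real N powr (1 / r)" using N by (simp add: powr_def log_def)
    finally have two: "real N powr (- (1 / r)) \<le> 1 / 2"
      using N by (simp add: powr_minus field_simps)
    have "real N powr (1 - 41 / r) = real N * real N powr (- (1 / r)) * real N powr (- (40 / r))"
    proof -
      have "1 - 41 / r = 1 + - (1 / r) + - (40 / r)" using r1 by (simp add: field_simps)
      then show ?thesis using N by (simp only: powr_add powr_one)
    qed
    also have "\<dots> \<le> real N * (1 / 2) * real N powr (- (40 / r))"
      using two by (intro mult_right_mono mult_left_mono) auto
    also have "\<dots> \<le> 2 ^ m * real N powr (- (40 / r))"
      using m(2) by (intro mult_right_mono) (auto simp: powr_add powr_realpow)
    also have "real N powr (- (40 / r)) = exp (- (40 / r * ln (real N)))"
      using N by (simp add: powr_def)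
    also have "2 ^ m * \<dots> \<le> 2 ^ m * exp (- (10 * real q powr (-1/4) * real m))"
      using e by (intro mult_left_mono) auto
    also note xs(3)
    finally show ?thesis using xs unfolding r_def by blast
  qed
qed auto

end
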